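(* Let $P$ be a partial order such that $P\Vdash$ "there is a real not in $V$" (i.e. there is a $P$-name $\dot r$ with $P\Vdash \dot r\in {}^\omega 2\setminus V$). Then there is a c.c.c. forcing $Q$ such that $Q\Vdash$ "forcing with $\check P$ adds a real which is Cohen-generic over $V^Q$".
   Context: A Cohen real over a model $M$ is a function $c\in{}^\omega 2$ generic over $M$ for the poset ${}^{<\omega}2$ ordered by reverse extension. *)

theory Defs
  imports Main "HOL-Library.Countable_Set" "HOL-Library.Sublist"
begin

section \<open>Forcing notions\<close>

text \<open>A forcing notion is a carrier \<open>C\<close> with a relation \<open>le\<close>, where \<open>(q, p) \<in> le\<close> reads
  ``\<open>q \<le> p\<close>'', i.e. \<open>q\<close> is the stronger condition.\<close>

definition below :: "'c set \<Rightarrow> 'c rel \<Rightarrow> 'c \<Rightarrow> 'c set" where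
  "below C le p = {q \<in> C. (q, p) \<in> le}"

definition compatible :: "'c set \<Rightarrow> 'c rel \<Rightarrow> 'c \<Rightarrow> 'c \<Rightarrow> bool" where
  "compatible C le p q \<longleftrightarrow> below C le p \<inter> below C le q \<noteq> {}"

definition ccc :: "'c set \<Rightarrow> 'c rel \<Rightarrow> bool" where
  "ccc C le \<longleftrightarrow>
     (\<forall>A \<subseteq> C. (\<forall>p\<in>A. \<forall>q\<in>A. p \<noteq> q \<longrightarrow> \<not> compatible C le p q) \<longrightarrow> countable A)"


section \<open>The forcing relation\<close>

text \<open>
  Sentences are embedded shallowly. A sentence of a model \<open>M\<close> is represented by its truth value, an
  element of a complete lattice \<open>'w\<close>; a sentence of the forcing language of \<open>C \<in> M\<close> is represented
  by the function \<open>\<phi> :: 'c \<Rightarrow> 'w\<close> where \<open>\<phi> p\<close> is the truth value in \<open>M\<close> of ``\<open>p\<close> forces \<open>\<phi>\<close>''.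
  Conjunction is \<open>inf\<close> and universal quantification is \<open>INF\<close>, both pointwise, which are the clauses
  of the forcing relation for these connectives. Hence the only thing that has to be recorded about
  \<open>M\<close> is its negation \<open>ng :: 'w \<Rightarrow> 'w\<close>:

  \<^item> for \<open>M = V\<close> we have \<open>'w = bool\<close> and \<open>ng = Not\<close>;
  \<^item> for \<open>M = V\<^sup>Q\<close> we have \<open>'w = ('q \<Rightarrow> bool)\<close> and \<open>ng = fnot Not Q leQ\<close>. Forcing over this \<open>M\<close>
    with the ground model poset \<open>P\<close> is forcing with \<open>P\<close>-check as defined inside \<open>V\<^sup>Q\<close>.
\<close>

definition fnot ::
  "('w \<Rightarrow> 'w) \<Rightarrow> 'c set \<Rightarrow> 'c rel \<Rightarrow> ('c \<Rightarrow> 'w) \<Rightarrow> 'c \<Rightarrow> 'w::complete_lattice" where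
  "fnot ng C le \<phi> = (\<lambda>p. INF q\<in>below C le p. ng (\<phi> q))"

definition forces :: "'c set \<Rightarrow> ('c \<Rightarrow> 'w) \<Rightarrow> 'w::complete_lattice" where
  "forces C \<phi> = (INF p\<in>C. \<phi> p)"

definition ex :: "('w \<Rightarrow> 'w) \<Rightarrow> 'x set \<Rightarrow> ('x \<Rightarrow> 'w) \<Rightarrow> 'w::complete_lattice" where
  "ex ng X \<phi> = ng (INF x\<in>X. ng (\<phi> x))"

definition imp :: "('w \<Rightarrow> 'w) \<Rightarrow> 'w \<Rightarrow> 'w \<Rightarrow> 'w::complete_lattice" where
  "imp ng \<phi> \<psi> = ng (inf \<phi> (ng \<psi>))"

text \<open>
  A subset, in \<open>M\<close>, of (the check of) a ground model set \<open>'a\<close> is given by the truth values of its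
  membership relation, \<open>A :: 'a \<Rightarrow> 'w\<close>. A \<open>C\<close>-name in \<open>M\<close> for a subset of \<open>'a\<close> is a set in \<open>M\<close> of
  pairs \<open>(x, s)\<close> with \<open>x\<close> in \<open>'a\<close> (standing for its check name) and \<open>s \<in> C\<close>. The sentence
  \<open>member ng C le \<tau> x\<close> says that \<open>x\<close> belongs to the evaluation of \<open>\<tau>\<close>: it is forced by \<open>p\<close> iff
  the conditions \<open>q\<close> with \<open>q \<le> s\<close> for some \<open>(x, s) \<in> \<tau>\<close> are dense below \<open>p\<close>.
\<close>

definition member ::
  "('w \<Rightarrow> 'w) \<Rightarrow> 'c set \<Rightarrow> 'c rel \<Rightarrow> ('a \<times> 'c \<Rightarrow> 'w) \<Rightarrow> 'a \<Rightarrow> 'c \<Rightarrow> 'w::complete_lattice" where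
  "member ng C le \<tau> x =
     (\<lambda>p. INF q\<in>below C le p. ex ng (below C le q)
            (\<lambda>q'. ex ng {s \<in> C. (q', s) \<in> le} (\<lambda>s. \<tau> (x, s))))"

text \<open>Posets need not have a largest element, so a check name pairs with every condition.\<close>

definition check :: "('a \<Rightarrow> 'w) \<Rightarrow> 'a \<times> 'c \<Rightarrow> 'w" where
  "check A = (\<lambda>(x, s). A x)"

text \<open>The subsets of \<open>'a\<close> in \<open>V\<^sup>Q\<close>, as evaluations of the \<open>Q\<close>-names for them.\<close>

definition ext_subsets :: "'q set \<Rightarrow> 'q rel \<Rightarrow> ('a \<Rightarrow> 'q \<Rightarrow> bool) set" where
  "ext_subsets Q le = range (member Not Q le)"


section \<open>Reals\<close>

text \<open>In the following sentences \<open>ng\<close> is the negation of the model in which they are interpreted,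
  and \<open>c\<close> is a subset of \<open>\<omega> \<times> 2\<close> in that model.\<close>

definition is_real :: "('w \<Rightarrow> 'w) \<Rightarrow> (nat \<times> bool \<Rightarrow> 'w) \<Rightarrow> 'w::complete_lattice" where
  "is_real ng c =
     (INF n. ex ng UNIV (\<lambda>b. inf (c (n, b)) (INF b'\<in>- {b}. ng (c (n, b')))))"

definition set_eq :: "('w \<Rightarrow> 'w) \<Rightarrow> ('a \<Rightarrow> 'w) \<Rightarrow> ('a \<Rightarrow> 'w) \<Rightarrow> 'w::complete_lattice" where
  "set_eq ng A B = (INF x. inf (imp ng (A x) (B x)) (imp ng (B x) (A x)))"

text \<open>The sentence ``\<open>\<tau>\<close> is in \<open>\<^sup>\<omega>2\<close> but not in \<open>V\<close>''. Only elements of \<open>\<^sup>\<omega>2 \<inter> V\<close> have to be excluded.\<close>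

definition new_real :: "'p set \<Rightarrow> 'p rel \<Rightarrow> ((nat \<times> bool) \<times> 'p \<Rightarrow> bool) \<Rightarrow> 'p \<Rightarrow> bool" where
  "new_real P le \<tau> =
     (let ng = fnot Not P le; r = member Not P le \<tau> in
       inf (is_real ng r)
           (INF x :: nat \<Rightarrow> bool.
              ng (set_eq ng r (member Not P le (check (\<lambda>(n, b). x n = b))))))"

definition adds_real :: "'p set \<Rightarrow> 'p rel \<Rightarrow> bool" where
  "adds_real P le \<longleftrightarrow> (\<exists>\<tau>. forces P (new_real P le \<tau>))"


section \<open>Cohen reals\<close>

text \<open>Density in the poset \<open>\<^sup><\<^sup>\<omega>2\<close>, where \<open>t \<le> s\<close> iff \<open>t\<close> end-extends \<open>s\<close>.\<close>

definition dense :: "('w \<Rightarrow> 'w) \<Rightarrow> (bool list \<Rightarrow> 'w) \<Rightarrow> 'w::complete_lattice" where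
  "dense ng D = (INF s. ex ng {t. prefix s t} D)"

text \<open>The filter \<open>{s. s \<subseteq> c}\<close> of finite initial segments of \<open>c\<close> meets \<open>D\<close>.\<close>

definition meets ::
  "('w \<Rightarrow> 'w) \<Rightarrow> (nat \<times> bool \<Rightarrow> 'w) \<Rightarrow> (bool list \<Rightarrow> 'w) \<Rightarrow> 'w::complete_lattice" where
  "meets ng c D = ex ng UNIV (\<lambda>s. inf (D s) (INF i\<in>{..<length s}. c (i, s ! i)))"

text \<open>The sentence of the forcing language of \<open>P\<close> over \<open>M\<close> saying that the \<open>P\<close>-name \<open>\<tau>\<close> is a Cohen
  real over \<open>M\<close>; here \<open>ng\<close> is the negation of \<open>M\<close>, and \<open>Ds\<close> is the collection of subsets of
  \<open>\<^sup><\<^sup>\<omega>2\<close> in \<open>M\<close>.\<close>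

definition cohen_over ::
  "('w \<Rightarrow> 'w) \<Rightarrow> (bool list \<Rightarrow> 'w) set \<Rightarrow> 'p set \<Rightarrow> 'p rel \<Rightarrow>
     ((nat \<times> bool) \<times> 'p \<Rightarrow> 'w) \<Rightarrow> 'p \<Rightarrow> 'w::complete_lattice" where
  "cohen_over ng Ds P le \<tau> =
     (let ng' = fnot ng P le; c = member ng P le \<tau> in
       inf (is_real ng' c)
           (INF D\<in>Ds. let D' = member ng P le (check D) in
              imp ng' (dense ng' D') (meets ng' c D')))"

text \<open>The sentence of the forcing language of \<open>Q\<close> saying: there is a \<open>P\<close>-check name \<open>\<tau>\<close> such that
  \<open>P\<close>-check forces \<open>\<tau>\<close> to be a Cohen real over \<open>V\<^sup>Q\<close>.\<close>

definition adds_cohen_over_ext ::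
  "'q set \<Rightarrow> 'q rel \<Rightarrow> 'p set \<Rightarrow> 'p rel \<Rightarrow> 'q \<Rightarrow> bool" where
  "adds_cohen_over_ext Q leQ P leP =
     (let ng = fnot Not Q leQ in
       ex ng (ext_subsets Q leQ)
         (\<lambda>\<tau>. forces P (cohen_over ng (ext_subsets Q leQ) P leP \<tau>)))"


section \<open>Adequacy of the encoding\<close>

lemma member_V:
  "member Not C le \<tau> x p \<longleftrightarrow>
     (\<forall>q\<in>below C le p. \<exists>q'\<in>below C le q. \<exists>s\<in>C. (q', s) \<in> le \<and> \<tau> (x, s))"
  by (simp add: member_def ex_def) blast

lemma ex_V: "ex (fnot Not C le) X \<phi> p \<longleftrightarrow>
    (\<forall>q\<in>below C le p. \<exists>q'\<in>below C le q. \<exists>x\<in>X. \<phi> x q')"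
  by (simp add: ex_def fnot_def) blast

lemma member_check_V:
  assumes "partial_order_on C le" "p \<in> C"
  shows "member Not C le (check A) x p \<longleftrightarrow> A x"
  using assms unfolding member_V check_def below_def partial_order_on_def preorder_on_def refl_on_def
  by auto

text \<open>Whatever object of \<open>V\<^sup>C\<close> is forced to be a subset of \<open>'a\<close>, the assignment sending \<open>x\<close> to the
  set of conditions forcing ``\<open>x\<close> belongs to it'' is a family of sets of conditions closed under
  strengthening and double negation. Names of the form above realise every such family, so
  quantifying over them amounts to quantifying over all subsets of \<open>'a\<close> in \<open>V\<^sup>C\<close>.\<close>

lemma names_exhaust:
  fixes A :: "'a \<Rightarrow> 'c \<Rightarrow> bool"
  assumes po: "partial_order_on C le"
    and mono: "\<And>x p q. p \<in> C \<Longrightarrow> q \<in> below C le p \<Longrightarrow> A x p \<Longrightarrow> A x q"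
    and reg: "\<And>x p. p \<in> C \<Longrightarrow> fnot Not C le (fnot Not C le (A x)) p \<Longrightarrow> A x p"
  shows "\<exists>\<tau>. \<forall>x. \<forall>p\<in>C. member Not C le \<tau> x p = A x p"
proof (intro exI allI ballI)
  fix x p assume p: "p \<in> C"
  have refl: "(q, q) \<in> le" if "q \<in> C" for q
    using po that by (auto simp: partial_order_on_def preorder_on_def refl_on_def)
  show "member Not C le (\<lambda>(x, s). A x s) x p = A x p"
  proof
    assume "member Not C le (\<lambda>(x, s). A x s) x p"
    then have "\<forall>q\<in>below C le p. \<exists>q'\<in>below C le q. A x q'"
      unfolding member_V using mono by (fastforce simp: below_def)
    then show "A x p" using reg[OF p] by (auto simp: fnot_def)
  next
    assume "A x p"
    then show "member Not C le (\<lambda>(x, s). A x s) x p"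
      unfolding member_V using mono[OF p] refl by (fastforce simp: below_def)
  qed
qed

end

theory Submission
  imports Defs
begin

text \<open>
  Fix a \<open>P\<close>-name \<open>r\<close> for a new real and, for each \<open>p \<in> P\<close>, a real \<open>x\<^sub>p \<in> V\<close> all of whose initial
  segments can be forced into \<open>r\<close> by conditions below \<open>p\<close>. Let \<open>Q\<close> be the \<open>\<sigma>\<close>-centred almost
  disjoint forcing adding a set \<open>a\<close> of finite binary strings by finite approximations, together with
  finitely many promises \<open>p\<close> that no further initial segment of \<open>x\<^sub>p\<close> enters \<open>a\<close>. As \<open>r\<close> differs from every
  real in \<open>V\<close>, it has infinitely many initial segments in \<open>a\<close>; the parities of their lengths form
  the Cohen real. Indeed, given \<open>(p, q)\<close>, promise \<open>p\<close>: this freezes the part \<open>u\<close> of the Cohen real read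
  along \<open>x\<^sub>p\<close>. Extend \<open>q\<close> to put some \<open>v \<supseteq> u\<close> into the given dense set of \<open>V\<^sup>Q\<close>, follow \<open>x\<^sub>p\<close> beyond
  all strings mentioned so far, let \<open>r\<close> leave all promised reals, and add initial segments of \<open>r\<close> to
  \<open>a\<close> that spell out the rest of \<open>v\<close>.
\<close>

section \<open>Elementary facts about strengthening a condition\<close>

lemma below_subset: "q \<in> below C le p \<Longrightarrow> q \<in> C"
  by (simp add: below_def)

lemma below_refl: "partial_order_on C le \<Longrightarrow> p \<in> C \<Longrightarrow> p \<in> below C le p"
  by (auto simp: below_def partial_order_on_def preorder_on_def refl_on_def)

lemma below_trans:
  "partial_order_on C le \<Longrightarrow> r \<in> below C le q \<Longrightarrow> q \<in> below C le p \<Longrightarrow> r \<in> below C le p"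
  by (auto simp: below_def partial_order_on_def preorder_on_def elim: transE)

lemma member_V_mono:
  assumes "partial_order_on C le" "member Not C le \<tau> x p" "q \<in> below C le p"
  shows "member Not C le \<tau> x q"
  using assms(2) below_trans[OF assms(1) _ assms(3)] unfolding member_V by blast

lemma fnot_V: "fnot Not C le \<phi> p \<longleftrightarrow> (\<forall>q\<in>below C le p. \<not> \<phi> q)"
  by (simp add: fnot_def)

section \<open>Iterated forcing with a ground model poset as product forcing\<close>

text \<open>Nesting the negation of \<open>V\<^sup>Q\<close> inside that for \<open>P\<close>
  strengthens both coordinates independently, so forcing with \<open>P\<close> over
  \<open>V\<^sup>Q\<close> is computed as in the product of \<open>P\<close> and
  \<open>Q\<close>.\<close>

lemma fnot_ext:
  "fnot (fnot Not Q leQ) P leP \<phi> p q \<longleftrightarrow>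
     (\<forall>p'\<in>below P leP p. \<forall>q'\<in>below Q leQ q. \<not> \<phi> p' q')"
  by (simp add: fnot_def)

lemma ex_ext:
  "ex (fnot (fnot Not Q leQ) P leP) X \<phi> p q \<longleftrightarrow>
     (\<forall>p'\<in>below P leP p. \<forall>q'\<in>below Q leQ q.
        \<exists>p''\<in>below P leP p'. \<exists>q''\<in>below Q leQ q'. \<exists>x\<in>X. \<phi> x p'' q'')"
  by (simp add: ex_def fnot_ext) blast

lemma member_ext:
  "member (fnot Not Q leQ) P leP \<tau> x p q \<longleftrightarrow>
     (\<forall>p'\<in>below P leP p. \<forall>q'\<in>below Q leQ q.
        \<exists>q''\<in>below Q leQ q'. \<exists>p''\<in>below P leP p'.
          \<forall>q3\<in>below Q leQ q''. \<exists>q4\<in>below Q leQ q3. \<exists>s\<in>P. (p'', s) \<in> leP \<and> \<tau> (x, s) q4)"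
  by (simp add: member_def ex_V Bex_def conj_assoc)

text \<open>A predicate on pairs that persists under strengthening yields a \<open>P\<close>-name in
  \<open>V\<^sup>Q\<close> whose membership is its double negation in the product. Persistence
  carries \<open>A\<close> from the conditions paired in the two nested names to those below
  them.\<close>

lemma member_ext_name:
  fixes A :: "'a \<Rightarrow> 'p \<Rightarrow> 'q \<Rightarrow> bool"
  assumes poP: "partial_order_on P leP" and poQ: "partial_order_on Q leQ"
    and mono: "\<And>x p q p' q'. A x p q \<Longrightarrow> p' \<in> below P leP p \<Longrightarrow> q' \<in> below Q leQ q \<Longrightarrow>
      p \<in> P \<Longrightarrow> q \<in> Q \<Longrightarrow> A x p' q'"
    and pq: "p \<in> P" "q \<in> Q"
  shows "member (fnot Not Q leQ) P leP (member Not Q leQ (\<lambda>((x, s), q). A x s q)) x p q \<longleftrightarrow>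
     (\<forall>p'\<in>below P leP p. \<forall>q'\<in>below Q leQ q.
        \<exists>p''\<in>below P leP p'. \<exists>q''\<in>below Q leQ q'. A x p'' q'')" (is "?L \<longleftrightarrow> ?R")
proof
  assume L: ?L
  show ?R
  proof (intro ballI)
    fix p' q' assume p': "p' \<in> below P leP p" and q': "q' \<in> below Q leQ q"
    obtain p'' q'' where p'': "p'' \<in> below P leP p'" and q'': "q'' \<in> below Q leQ q'"
      and d: "\<forall>q3\<in>below Q leQ q''. \<exists>q4\<in>below Q leQ q3. \<exists>s\<in>P. (p'', s) \<in> leP \<and>
                 member Not Q leQ (\<lambda>((x, s), q). A x s q) (x, s) q4"
      using L p' q' unfolding member_ext by blast
    obtain q4 s where q4: "q4 \<in> below Q leQ q''" and s: "s \<in> P" "(p'', s) \<in> leP"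
      and m: "member Not Q leQ (\<lambda>((x, s), q). A x s q) (x, s) q4"
      using d below_refl[OF poQ below_subset[OF q'']] by blast
    obtain q5 s' where q5: "q5 \<in> below Q leQ q4" and s': "s' \<in> Q" "(q5, s') \<in> leQ" "A x s s'"
      using m below_refl[OF poQ below_subset[OF q4]] unfolding member_V by fastforce
    have "A x p'' q5"
      using mono[OF s'(3), of p'' q5] s s' p'' q5 by (simp add: below_def)
    then show "\<exists>p''\<in>below P leP p'. \<exists>q''\<in>below Q leQ q'. A x p'' q''"
      using p'' below_trans[OF poQ below_trans[OF poQ q5 q4] q''] by blast
  qed
next
  assume R: ?R
  show ?L
    unfolding member_ext
  proof (intro ballI)
    fix p' q' assume p': "p' \<in> below P leP p" and q': "q' \<in> below Q leQ q"
    obtain p'' q'' where p'': "p'' \<in> below P leP p'" and q'': "q'' \<in> below Q leQ q'"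
      and A: "A x p'' q''" using R p' q' by blast
    have "member Not Q leQ (\<lambda>((x, s), q). A x s q) (x, p'') q3" if q3: "q3 \<in> below Q leQ q''" for q3
      unfolding member_V prod.case
    proof
      fix q4 assume "q4 \<in> below Q leQ q3"
      then have q4: "q4 \<in> below Q leQ q''" by (rule below_trans[OF poQ _ q3])
      then have "(q4, q'') \<in> leQ" by (simp add: below_def)
      then show "\<exists>q'\<in>below Q leQ q4. \<exists>s\<in>Q. (q', s) \<in> leQ \<and> A x p'' s"
        using A below_refl[OF poQ below_subset[OF q4]] below_subset[OF q''] by auto
    qed
    moreover have "(p'', p'') \<in> leP" "p'' \<in> P"
      using below_refl[OF poP below_subset[OF p'']] by (auto simp: below_def)
    ultimately show "\<exists>q''\<in>below Q leQ q'. \<exists>p''\<in>below P leP p'. \<forall>q3\<in>below Q leQ q''.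
      \<exists>q4\<in>below Q leQ q3. \<exists>s\<in>P. (p'', s) \<in> leP \<and>
        member Not Q leQ (\<lambda>((x, s), q). A x s q) (x, s) q4"
      using p'' q'' below_refl[OF poQ] below_subset by metis
  qed
qed

lemma member_ext_checkI:
  assumes poP: "partial_order_on P leP" and poQ: "partial_order_on Q leQ"
    and pq: "p \<in> P" "q \<in> Q" and D: "member Not Q leQ \<delta> s q"
  shows "member (fnot Not Q leQ) P leP (check (member Not Q leQ \<delta>)) s p q"
  unfolding member_ext check_def prod.case
proof (intro ballI)
  fix p' q' assume p': "p' \<in> below P leP p" and q': "q' \<in> below Q leQ q"
  have p'r: "p' \<in> P" "p' \<in> below P leP p'" "(p', p') \<in> leP"
    using below_refl[OF poP below_subset[OF p']] by (auto simp: below_def)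
  have q'r: "q' \<in> below Q leQ q'" using below_refl[OF poQ below_subset[OF q']] .
  have "member Not Q leQ \<delta> s q3 \<and> q3 \<in> below Q leQ q3" if "q3 \<in> below Q leQ q'" for q3
    using member_V_mono[OF poQ D below_trans[OF poQ that q']]
      below_refl[OF poQ below_subset[OF that]] by simp
  then show "\<exists>q''\<in>below Q leQ q'. \<exists>p''\<in>below P leP p'. \<forall>q3\<in>below Q leQ q''.
      \<exists>q4\<in>below Q leQ q3. \<exists>t\<in>P. (p'', t) \<in> leP \<and> member Not Q leQ \<delta> s q4"
    using p'r q'r by blast
qed

text \<open>A check name pairs with every condition of \<open>P\<close>, so membership in it is
  decided on the \<open>Q\<close> side alone; undoing the double negation costs one strengthening of
  \<open>q\<close>.\<close>

lemma member_ext_checkD: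
  assumes poP: "partial_order_on P leP" and poQ: "partial_order_on Q leQ"
    and pq: "p \<in> P" "q \<in> Q"
    and D: "member (fnot Not Q leQ) P leP (check A) s p q"
  shows "\<exists>q'\<in>below Q leQ q. A s q'"
proof -
  have pr: "p \<in> below P leP p" and qr: "q \<in> below Q leQ q"
    using below_refl[OF poP pq(1)] below_refl[OF poQ pq(2)] .
  obtain q'' where q'': "q'' \<in> below Q leQ q"
    and d: "\<forall>q3\<in>below Q leQ q''. \<exists>q4\<in>below Q leQ q3. A s q4"
    using D[unfolded member_ext check_def prod.case, THEN bspec, OF pr, THEN bspec, OF qr] by auto
  then obtain q4 where "q4 \<in> below Q leQ q''" "A s q4"
    using below_refl[OF poQ below_subset[OF q'']] by blast
  then show ?thesis using below_trans[OF poQ _ q''] by blast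
qed

section \<open>The name for the new real\<close>

definition initial :: "bool list \<Rightarrow> (nat \<Rightarrow> bool) \<Rightarrow> bool" where
  "initial t x \<longleftrightarrow> (\<forall>i<length t. t ! i = x i)"

lemma initial_prefix: "prefix s t \<Longrightarrow> initial t x \<Longrightarrow> initial s x"
  unfolding initial_def prefix_def by (metis nth_append length_append trans_less_add1)

locale new_real_name =
  fixes P :: "'p set" and leP :: "'p rel" and \<tau> :: "(nat \<times> bool) \<times> 'p \<Rightarrow> bool"
  assumes po: "partial_order_on P leP"
    and new: "forces P (new_real P leP \<tau>)"
begin

abbreviation dn :: "'p \<Rightarrow> 'p set" where "dn \<equiv> below P leP"

definition rbit :: "nat \<Rightarrow> bool \<Rightarrow> 'p \<Rightarrow> bool" where
  "rbit n b p = member Not P leP \<tau> (n, b) p"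

lemmas dn_refl = below_refl[OF po] and dn_trans = below_trans[OF po]

lemma rbit_mono: "rbit n b p \<Longrightarrow> p' \<in> dn p \<Longrightarrow> rbit n b p'"
  unfolding rbit_def by (rule member_V_mono[OF po])

lemma rbit_decided_uniquely:
  assumes "p \<in> P"
  shows "\<exists>p'\<in>dn p. \<exists>b. rbit n b p' \<and> (\<forall>b'\<in>- {b}. \<forall>p''\<in>dn p'. \<not> rbit n b' p'')"
proof -
  have "is_real (fnot Not P leP) (member Not P leP \<tau>) p"
    using new assms by (simp add: forces_def new_real_def Let_def)
  then have "\<forall>p1\<in>dn p. \<exists>p'\<in>dn p1. \<exists>b. rbit n b p' \<and> (\<forall>b'\<in>- {b}. \<forall>p''\<in>dn p'. \<not> rbit n b' p'')"
    unfolding is_real_def by (simp add: ex_V fnot_V rbit_def)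
  then show ?thesis using dn_refl[OF assms] by blast
qed

lemma rbit_unique:
  assumes "p \<in> P" "rbit n b p" "rbit n b' p"
  shows "b = b'"
proof -
  obtain p' b0 where p': "p' \<in> dn p"
    and u: "\<forall>b'\<in>- {b0}. \<forall>p''\<in>dn p'. \<not> rbit n b' p''"
    using rbit_decided_uniquely[OF assms(1)] by blast
  have "p' \<in> dn p'" using dn_refl below_subset[OF p'] by blast
  then show ?thesis using u assms(2,3) p' rbit_mono by (metis ComplI singletonD)
qed

text \<open>As \<open>p\<close> cannot force the two sets equal, one inclusion fails below
  \<open>p\<close>: either the new real contains a pair outside \<open>x\<close>, or it omits a pair
  of \<open>x\<close> and, being total, takes the other bit there.\<close>

lemma rbit_new:
  assumes "p \<in> P"
  shows "\<exists>p'\<in>dn p. \<exists>n. rbit n (\<not> x n) p'"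
proof -
  let ?ng = "fnot Not P leP"
  let ?chk = "member Not P leP (check (\<lambda>(n, b). x n = b))"
  have "?ng (set_eq ?ng (member Not P leP \<tau>) ?chk) p"
    using new assms by (simp add: forces_def new_real_def Let_def)
  then have "\<not> set_eq ?ng (member Not P leP \<tau>) ?chk p"
    using dn_refl[OF assms] by (simp add: fnot_V)
  then obtain n b where "\<not> imp ?ng (member Not P leP \<tau> (n, b)) (?chk (n, b)) p \<or>
      \<not> imp ?ng (?chk (n, b)) (member Not P leP \<tau> (n, b)) p"
    unfolding set_eq_def by auto
  then consider p' where "p' \<in> dn p" "rbit n b p'" "\<forall>p''\<in>dn p'. \<not> ?chk (n, b) p''"
    | p' where "p' \<in> dn p" "?chk (n, b) p'" "\<forall>p''\<in>dn p'. \<not> rbit n b p''"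
    by (auto simp: imp_def fnot_V rbit_def)
  then show ?thesis
  proof cases
    case 1
    have "p' \<in> dn p'" using dn_refl below_subset[OF 1(1)] by blast
    then have "b = (\<not> x n)"
      using 1(3) member_check_V[OF po below_subset[OF 1(1)], of "\<lambda>(n, b). x n = b" "(n, b)"] by auto
    then show ?thesis using 1(1,2) by blast
  next
    case 2
    have x: "x n = b"
      using 2(2) member_check_V[OF po below_subset[OF 2(1)], of "\<lambda>(n, b). x n = b" "(n, b)"] by auto
    obtain p'' b'' where p'': "p'' \<in> dn p'" "rbit n b'' p''"
      using rbit_decided_uniquely[OF below_subset[OF 2(1)]] by blast
    then have "b'' \<noteq> b" using 2(3) by blast
    then have "b'' = (\<not> x n)" using x by auto
    then show ?thesis using p'' dn_trans[OF p''(1) 2(1)] by blast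
  qed
qed

section \<open>Initial segments of the new real decided by a condition\<close>

definition dec :: "'p \<Rightarrow> bool list \<Rightarrow> bool" where
  "dec p t \<longleftrightarrow> (\<forall>i<length t. rbit i (t ! i) p)"

lemma dec_mono: "dec p t \<Longrightarrow> p' \<in> dn p \<Longrightarrow> dec p' t"
  unfolding dec_def using rbit_mono by blast

lemma dec_comparable:
  assumes "p \<in> P" "dec p s" "dec p t" "length s \<le> length t"
  shows "prefix s t"
proof -
  have "s = take (length s) t"
  proof (rule nth_equalityI)
    fix i assume i: "i < length s"
    then have "rbit i (s ! i) p" "rbit i (t ! i) p" using assms(2-4) by (simp_all add: dec_def)
    then show "s ! i = take (length s) t ! i" using rbit_unique[OF assms(1)] i by simp
  qed (use assms(4) in simp)
  then show ?thesis by (metis take_is_prefix)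
qed

lemma dec_extend_one:
  assumes "p \<in> P" "dec p t"
  shows "\<exists>p'\<in>dn p. \<exists>b. dec p' (t @ [b])"
proof -
  obtain p' b where p': "p' \<in> dn p" "rbit (length t) b p'"
    using rbit_decided_uniquely[OF assms(1)] by blast
  then have "dec p' (t @ [b])"
    using dec_mono[OF assms(2) p'(1)] by (auto simp: dec_def nth_append less_Suc_eq)
  then show ?thesis using p' by blast
qed

lemma dec_extend:
  assumes "p \<in> P" "dec p t"
  shows "\<exists>p'\<in>dn p. \<exists>t'. prefix t t' \<and> length t' = length t + n \<and> dec p' t'"
proof (induction n)
  case 0
  then show ?case using assms dn_refl by auto
next
  case (Suc n)
  then obtain p' t' where p': "p' \<in> dn p" and t': "prefix t t'" "length t' = length t + n" "dec p' t'"
    by blast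
  obtain p'' b where p'': "p'' \<in> dn p'" "dec p'' (t' @ [b])"
    using dec_extend_one[OF below_subset[OF p'] t'(3)] by blast
  have "prefix t (t' @ [b]) \<and> length (t' @ [b]) = length t + Suc n \<and> dec p'' (t' @ [b])"
    using t' p'' by (simp add: prefix_def) (metis append.assoc)
  then show ?case using dn_trans[OF p''(1) p'] by blast
qed

text \<open>Reals are avoided one at a time: some bit \<open>n\<close> is forced to differ from
  \<open>x\<close>, and \<open>Suc n\<close> further bits make the decided string long enough to
  show it. Longer strings still avoid the earlier reals.\<close>

lemma dec_avoid:
  assumes "finite F" "p \<in> P" "dec p t"
  shows "\<exists>p'\<in>dn p. \<exists>t'. prefix t t' \<and> dec p' t' \<and> (\<forall>x\<in>F. \<not> initial t' x)"
  using assms(1)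
proof (induction F rule: finite_induct)
  case empty
  then show ?case using assms dn_refl by auto
next
  case (insert x F)
  then obtain p' t' where p': "p' \<in> dn p" and t': "prefix t t'" "dec p' t'" "\<forall>x\<in>F. \<not> initial t' x"
    by blast
  obtain p1 n where p1: "p1 \<in> dn p'" "rbit n (\<not> x n) p1"
    using rbit_new[OF below_subset[OF p']] by blast
  obtain p2 t2 where p2: "p2 \<in> dn p1" and t2: "prefix t' t2" "length t2 = length t' + Suc n" "dec p2 t2"
    using dec_extend[OF below_subset[OF p1(1)] dec_mono[OF t'(2) p1(1)]] by blast
  have "rbit n (t2 ! n) p2" using t2 by (simp add: dec_def)
  then have "t2 ! n = (\<not> x n)"
    using rbit_unique[OF below_subset[OF p2]] rbit_mono[OF p1(2) p2] by blast
  moreover have "n < length t2" using t2(2) by simp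
  ultimately have "\<not> initial t2 x" unfolding initial_def by metis
  moreover have "\<forall>x\<in>F. \<not> initial t2 x" using t'(3) initial_prefix[OF t2(1)] by blast
  moreover have "prefix t t2" using t'(1) t2(1) by (rule prefix_order.trans)
  moreover have "p2 \<in> dn p" using p2 p1(1) p' dn_trans by blast
  ultimately show ?case using t2(3) by blast
qed

text \<open>A descending sequence below \<open>p\<close> decides one more bit at each step, and
  these bits form \<open>x\<close>. The sequence may lack a lower bound, but each finite segment is
  decided by a single member.\<close>

lemma branch_exists:
  assumes "p \<in> P"
  shows "\<exists>x. \<forall>t. initial t x \<longrightarrow> (\<exists>p'\<in>dn p. dec p' t)"
proof -
  have "\<exists>f. \<forall>n. f n \<in> dn p \<and> (f (Suc n) \<in> dn (f n) \<and> (\<exists>b. rbit n b (f (Suc n))))"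
  proof (rule dependent_nat_choice)
    show "\<exists>q. q \<in> dn p" using dn_refl[OF assms] by blast
    show "\<exists>q'. q' \<in> dn p \<and> (q' \<in> dn q \<and> (\<exists>b. rbit n b q'))" if "q \<in> dn p" for q n
      using rbit_decided_uniquely[OF below_subset[OF that]] dn_trans[OF _ that] by blast
  qed
  then obtain f where f: "\<And>n. f n \<in> dn p" "\<And>n. f (Suc n) \<in> dn (f n)" "\<And>n. \<exists>b. rbit n b (f (Suc n))"
    by blast
  obtain x where x: "\<And>n. rbit n (x n) (f (Suc n))" using f(3) by metis
  have mono: "f (n + k) \<in> dn (f n)" for n k
  proof (induction k)
    case 0
    show ?case using dn_refl[OF below_subset[OF f(1)]] by simp
  next
    case (Suc k)
    then show ?case using dn_trans[OF f(2)] by simp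
  qed
  have "dec (f (length t)) t" if "initial t x" for t
    unfolding dec_def
  proof (intro allI impI)
    fix i assume i: "i < length t"
    then have "f (length t) \<in> dn (f (Suc i))"
      using mono[of "Suc i" "length t - Suc i"] by (metis Suc_leI le_add_diff_inverse)
    then show "rbit i (t ! i) (f (length t))"
      using rbit_mono[OF x[of i]] that i by (simp add: initial_def)
  qed
  then show ?thesis using f(1) by blast
qed

text \<open>The real \<open>x\<^sub>p\<close> of the overview, fixed by choice so that a promise can
  name it by \<open>p\<close> alone.\<close>

definition branch :: "'p \<Rightarrow> nat \<Rightarrow> bool" where
  "branch p = (SOME x. \<forall>t. initial t x \<longrightarrow> (\<exists>p'\<in>dn p. dec p' t))"

lemma branch: "p \<in> P \<Longrightarrow> initial t (branch p) \<Longrightarrow> \<exists>p'\<in>dn p. dec p' t"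
  using someI_ex[OF branch_exists, folded branch_def] by blast

text \<open>Some condition below \<open>p\<close> decides the equally long segment of the branch,
  and it must agree with what \<open>p\<close> already decides.\<close>

lemma initial_branch:
  assumes "p \<in> P" "dec p t"
  shows "initial t (branch p)"
proof -
  let ?s = "map (branch p) [0..<length t]"
  have s: "initial ?s (branch p)" by (simp add: initial_def)
  then obtain p' where "p' \<in> dn p" "dec p' ?s" using branch[OF assms(1)] by blast
  then have "prefix t ?s" using dec_comparable dec_mono[OF assms(2)] below_subset by fastforce
  then show ?thesis using s initial_prefix by blast
qed

section \<open>The almost disjoint forcing along the new real\<close>

text \<open>A condition is a finite set containing codes of the strings put into \<open>a\<close> and the promises;
  numbers that code no string are harmless.\<close>

definition strs :: "(nat + 'p) set \<Rightarrow> bool list set" where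
  "strs q = {t. Inl (to_nat t) \<in> q}"

definition promise :: "(nat + 'p) set \<Rightarrow> 'p set" where
  "promise q = {p. Inr p \<in> q}"

definition Q :: "(nat + 'p) set set" where
  "Q = {q. finite q}"

definition leQ :: "(nat + 'p) set rel" where
  "leQ = {(q', q). q' \<in> Q \<and> q \<in> Q \<and> q \<subseteq> q' \<and>
     (\<forall>t \<in> strs q' - strs q. \<forall>p \<in> promise q. \<not> initial t (branch p))}"

abbreviation dnQ :: "(nat + 'p) set \<Rightarrow> (nat + 'p) set set" where "dnQ \<equiv> below Q leQ"

lemma strs_mono: "q \<subseteq> q' \<Longrightarrow> strs q \<subseteq> strs q'"
  and promise_mono: "q \<subseteq> q' \<Longrightarrow> promise q \<subseteq> promise q'"
  by (auto simp: strs_def promise_def)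

lemma po_Q: "partial_order_on Q leQ"
proof -
  have "trans leQ"
  proof (rule transI)
    fix q'' q' q assume "(q'', q') \<in> leQ" "(q', q) \<in> leQ"
    then show "(q'', q) \<in> leQ"
      using promise_mono[of q q'] unfolding leQ_def by blast
  qed
  then show ?thesis
    by (auto simp: partial_order_on_def preorder_on_def refl_on_def antisym_def leQ_def)
qed

lemmas dnQ_refl = below_refl[OF po_Q] and dnQ_trans = below_trans[OF po_Q]

lemma finite_strs: "q \<in> Q \<Longrightarrow> finite (strs q)"
  unfolding strs_def Q_def
  using finite_vimageI[of q "\<lambda>t. Inl (to_nat t)"] by (auto simp: inj_def vimage_def)

lemma finite_promise: "q \<in> Q \<Longrightarrow> finite (promise q)"
  unfolding promise_def Q_def
  using finite_vimageI[of q Inr] by (auto simp: vimage_def)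

text \<open>Conditions with the same strings are compatible: their union adds no string, so it
  breaks no promise. An antichain therefore injects into the countable family of finite sets of
  strings.\<close>

lemma ccc_Q: "ccc Q leQ"
  unfolding ccc_def
proof (intro allI impI)
  fix A assume A: "A \<subseteq> Q" and anti: "\<forall>p\<in>A. \<forall>q\<in>A. p \<noteq> q \<longrightarrow> \<not> compatible Q leQ p q"
  have "inj_on (\<lambda>q. strs q) A"
  proof (rule inj_onI, rule ccontr)
    fix p q assume pq: "p \<in> A" "q \<in> A" "strs p = strs q" "p \<noteq> q"
    have "strs (p \<union> q) = strs p" using pq(3) by (auto simp: strs_def)
    then have "p \<union> q \<in> dnQ p" "p \<union> q \<in> dnQ q"
      using pq A by (auto simp: below_def leQ_def Q_def)
    then show False using anti pq by (auto simp: compatible_def)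
  qed
  moreover have "countable (strs ` A)"
    by (rule countable_subset[OF _ countable_Collect_finite]) (use A finite_strs in auto)
  ultimately show "countable A" by (simp add: countable_image_inj_eq)
qed

lemma insert_promise_dnQ: "q \<in> Q \<Longrightarrow> insert (Inr p) q \<in> dnQ q"
  by (auto simp: below_def leQ_def Q_def strs_def)

lemma insert_str_dnQ:
  assumes "q \<in> Q" "\<forall>p\<in>promise q. \<not> initial t (branch p)"
  shows "insert (Inl (to_nat t)) q \<in> dnQ q"
  using assms by (auto simp: below_def leQ_def Q_def strs_def)

lemma strs_insert_str: "strs (insert (Inl (to_nat t)) q) = insert t (strs q)"
  by (auto simp: strs_def)

text \<open>If \<open>a\<close> is the generic set of strings and \<open>t\<close> an initial segment of the new real, then
  \<open>read a t\<close> is an initial segment of the Cohen real: its bits are the parities of the levels at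
  which the new real passes through \<open>a\<close>.\<close>

definition read :: "bool list set \<Rightarrow> bool list \<Rightarrow> bool list" where
  "read a t = map even (filter (\<lambda>i. take i t \<in> a) [0..<length t])"

lemma read_split:
  "read a (s @ u) = read a s @
     map even (filter (\<lambda>i. take i (s @ u) \<in> a) [length s..<length (s @ u)])"
proof -
  have "[0..<length (s @ u)] = [0..<length s] @ [length s..<length (s @ u)]"
    using upt_add_eq_append[of 0 "length s" "length u"] by simp
  moreover have "filter (\<lambda>i. take i (s @ u) \<in> a) [0..<length s] = filter (\<lambda>i. take i s \<in> a) [0..<length s]"
    by (rule filter_cong) auto
  ultimately show ?thesis by (simp only: read_def filter_append map_append)
qed

lemma read_prefix: "prefix s t \<Longrightarrow> prefix (read a s) (read a t)"
  unfolding prefix_def using read_split by blast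

lemma read_cong:
  assumes "\<And>s. prefix s t \<Longrightarrow> s \<in> a \<longleftrightarrow> s \<in> b"
  shows "read a t = read b t"
  unfolding read_def by (rule arg_cong[of _ _ "map even"], rule filter_cong) (auto simp: assms take_is_prefix)

lemma read_extend:
  assumes "prefix s t" "\<And>v. v \<in> a \<Longrightarrow> length v < length s"
  shows "read a t = read a s"
proof -
  obtain u where t: "t = s @ u" using assms by (auto simp: prefix_def)
  have "filter (\<lambda>i. take i (s @ u) \<in> a) [length s..<length (s @ u)] = []"
    using assms(2) by (fastforce simp: filter_empty_conv)
  then show ?thesis by (simp only: t read_split) simp
qed

lemma read_snoc: "read a (t @ [b]) = read a t @ (if t \<in> a then [even (length t)] else [])"
  by (subst read_split) simp

text \<open>A promise bars new strings along its branch, so the reading there is frozen.\<close>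

lemma read_dnQ:
  assumes "q' \<in> dnQ q" "p \<in> promise q" "initial t (branch p)"
  shows "read (strs q') t = read (strs q) t"
proof (rule read_cong)
  fix s assume "prefix s t"
  then have "initial s (branch p)" using assms(3) initial_prefix by blast
  then show "s \<in> strs q' \<longleftrightarrow> s \<in> strs q"
    using assms(1,2) strs_mono[of q q'] by (auto simp: below_def leQ_def)
qed

text \<open>Once the new real has left every promised branch, strings may be added along it; adding
  one whose length has the right parity appends the bit. The length bound keeps the skipped levels
  silent and is restored for iteration.\<close>

lemma read_append_bit:
  assumes "p \<in> P" "q \<in> Q" "dec p t" and len: "\<And>v. v \<in> strs q \<Longrightarrow> length v < length t"
  shows "\<exists>p'\<in>dn p. \<exists>q'\<in>dnQ q. \<exists>t'. dec p' t' \<and>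
    (\<forall>v\<in>strs q'. length v < length t') \<and> read (strs q') t' = read (strs q) t @ [b]"
proof -
  obtain p1 t1 where p1: "p1 \<in> dn p" and t1: "prefix t t1" "dec p1 t1"
      "\<forall>x\<in>branch ` promise q. \<not> initial t1 x"
    using dec_avoid[OF finite_imageI[OF finite_promise[OF assms(2)]] assms(1,3)] by blast
  obtain k where k: "even (length t1 + k) = b"
    by (metis add_0_right even_add odd_one)
  obtain p2 t2 where p2: "p2 \<in> dn p1" and t2: "prefix t1 t2" "length t2 = length t1 + k" "dec p2 t2"
    using dec_extend[OF below_subset[OF p1] t1(2)] by blast
  \<comment> \<open>\<open>read\<close> inspects only levels strictly below the length of its
    argument, so one more bit must be decided before \<open>t2\<close> counts.\<close>
  obtain p3 b' where p3: "p3 \<in> dn p2" "dec p3 (t2 @ [b'])"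
    using dec_extend_one[OF below_subset[OF p2] t2(3)] by blast
  define q' where "q' = insert (Inl (to_nat t2)) q"
  have tt2: "prefix t t2" using t1(1) t2(1) by (rule prefix_order.trans)
  have "\<forall>p\<in>promise q. \<not> initial t2 (branch p)" using t1(3) initial_prefix[OF t2(1)] by blast
  then have q': "q' \<in> dnQ q" unfolding q'_def by (rule insert_str_dnQ[OF assms(2)])
  have S: "strs q' = insert t2 (strs q)" by (simp add: q'_def strs_insert_str)
  have "length t \<le> length t2" using tt2 by (rule prefix_length_le)
  then have l: "\<forall>v\<in>strs q'. length v < length (t2 @ [b'])" using len S by fastforce
  \<comment> \<open>Only proper prefixes of \<open>t2\<close> are inspected, so adding
    \<open>t2\<close> changes nothing yet.\<close>
  have "read (strs q') t2 = read (strs q) t2"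
    unfolding read_def S by (rule arg_cong[of _ _ "map even"], rule filter_cong) auto
  also have "\<dots> = read (strs q) t" by (rule read_extend[OF tt2 len])
  finally have "read (strs q') (t2 @ [b']) = read (strs q) t @ [b]"
    using k t2(2) S by (simp add: read_snoc)
  moreover have "p3 \<in> dn p" using p1 p2 p3 dn_trans by blast
  ultimately show ?thesis using q' l p3(2) by blast
qed

lemma read_append:
  assumes "p \<in> P" "q \<in> Q" "dec p t" and len: "\<And>v. v \<in> strs q \<Longrightarrow> length v < length t"
  shows "\<exists>p'\<in>dn p. \<exists>q'\<in>dnQ q. \<exists>t'. dec p' t' \<and>
    (\<forall>v\<in>strs q'. length v < length t') \<and> read (strs q') t' = read (strs q) t @ w"
proof (induction w rule: rev_induct)
  case Nil
  show ?case
    using dn_refl[OF assms(1)] dnQ_refl[OF assms(2)] assms(3) len by auto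
next
  case (snoc b w)
  then obtain p' q' t' where 1: "p' \<in> dn p" "q' \<in> dnQ q" "dec p' t'"
    "\<forall>v\<in>strs q'. length v < length t'" "read (strs q') t' = read (strs q) t @ w"
    by blast
  obtain p'' q'' t'' where 2: "p'' \<in> dn p'" "q'' \<in> dnQ q'" "dec p'' t''"
    "\<forall>v\<in>strs q''. length v < length t''" "read (strs q'') t'' = read (strs q') t' @ [b]"
    using read_append_bit[OF below_subset[OF 1(1)] below_subset[OF 1(2)] 1(3), of b] 1(4) by blast
  show ?case
    using 2 1(5) dn_trans[OF 2(1) 1(1)] dnQ_trans[OF 2(2) 1(2)]
    by (metis append.assoc)
qed

section \<open>The Cohen real\<close>

text \<open>The promise made at \<open>t\<close> ensures that the value of \<open>read\<close> at \<open>t\<close> is final.\<close>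

definition settled :: "bool list \<Rightarrow> 'p \<Rightarrow> (nat + 'p) set \<Rightarrow> bool" where
  "settled u p q \<longleftrightarrow> (\<exists>t. dec p t \<and> (\<exists>p0\<in>promise q. initial t (branch p0)) \<and> prefix u (read (strs q) t))"

definition cbit :: "nat \<times> bool \<Rightarrow> 'p \<Rightarrow> (nat + 'p) set \<Rightarrow> bool" where
  "cbit = (\<lambda>(n, b) p q. \<exists>u. settled u p q \<and> n < length u \<and> u ! n = b)"

lemma settled_mono:
  assumes "settled u p q" "p' \<in> dn p" "q' \<in> dnQ q"
  shows "settled u p' q'"
proof -
  obtain t p0 where t: "dec p t" "p0 \<in> promise q" "initial t (branch p0)" "prefix u (read (strs q) t)"
    using assms(1) by (auto simp: settled_def)
  have "p0 \<in> promise q'" using t(2) promise_mono[of q q'] assms(3) by (auto simp: below_def leQ_def)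
  then show ?thesis
    unfolding settled_def
    using dec_mono[OF t(1) assms(2)] read_dnQ[OF assms(3) t(2,3)] t(3,4) by metis
qed

lemma settled_comparable:
  assumes "p \<in> P" "settled u p q" "settled v p q"
  shows "prefix u v \<or> prefix v u"
proof -
  obtain s t where st: "dec p s" "prefix u (read (strs q) s)" "dec p t" "prefix v (read (strs q) t)"
    using assms(2,3) by (auto simp: settled_def)
  have "prefix s t \<or> prefix t s"
    using dec_comparable[OF assms(1)] st(1,3) by (meson linear)
  then show ?thesis
    using read_prefix st(2,4) by (meson prefix_order.trans prefix_same_cases)
qed

lemma cbit_mono: "cbit x p q \<Longrightarrow> p' \<in> dn p \<Longrightarrow> q' \<in> dnQ q \<Longrightarrow> cbit x p' q'"
  unfolding cbit_def using settled_mono by (cases x) (simp, blast)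

lemma cbit_unique:
  assumes "p \<in> P" "cbit (n, b) p q" "cbit (n, b') p q"
  shows "b = b'"
proof -
  obtain u v where "settled u p q" "n < length u" "u ! n = b" "settled v p q" "n < length v" "v ! n = b'"
    using assms(2,3) by (auto simp: cbit_def)
  moreover from this have "prefix u v \<or> prefix v u"
    using settled_comparable[OF assms(1)] by blast
  ultimately show ?thesis by (metis prefix_def nth_append)
qed

text \<open>Strings decided by \<open>p\<close> lie on the branch of \<open>p\<close>, so promising
  \<open>p\<close> itself makes the reading at \<open>t\<close> final.\<close>

lemma settled_promiseI:
  assumes "p \<in> P" "dec p t" "prefix u (read (strs q) t)"
  shows "settled u p (insert (Inr p) q)"
proof -
  have "strs (insert (Inr p) q) = strs q" by (simp add: strs_def)
  then show ?thesis
    unfolding settled_def using assms initial_branch[OF assms(1,2)]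
    by (auto simp: promise_def)
qed

lemma length_bound: "q \<in> Q \<Longrightarrow> \<exists>L. \<forall>v\<in>strs q. length v < L"
  using finite_strs[of q] finite_nat_set_iff_bounded[of "length ` strs q"] by auto

text \<open>The source of totality of the Cohen real: \<open>Suc n\<close> arbitrary bits are
  appended, and promising the resulting condition of \<open>P\<close> settles them.\<close>

lemma settled_long:
  assumes "p \<in> P" "q \<in> Q"
  shows "\<exists>p'\<in>dn p. \<exists>q'\<in>dnQ q. \<exists>u. n < length u \<and> settled u p' q'"
proof -
  obtain L where L: "\<forall>v\<in>strs q. length v < L" using length_bound[OF assms(2)] by blast
  obtain p1 t where p1: "p1 \<in> dn p" and t: "dec p1 t" "length t = L"
    using dec_extend[OF assms(1), of "[]" L] by (auto simp: dec_def)
  obtain p2 q2 t2 where 2: "p2 \<in> dn p1" "q2 \<in> dnQ q" "dec p2 t2"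
    "read (strs q2) t2 = read (strs q) t @ replicate (Suc n) True"
    using read_append[OF below_subset[OF p1] assms(2) t(1)] L t(2) by blast
  have "settled (read (strs q2) t2) p2 (insert (Inr p2) q2)"
    using settled_promiseI[OF below_subset[OF 2(1)] 2(3)] by simp
  moreover have "n < length (read (strs q2) t2)" by (simp add: 2(4))
  moreover have "p2 \<in> dn p" using dn_trans[OF 2(1) p1] .
  moreover have "insert (Inr p2) q2 \<in> dnQ q"
    using dnQ_trans[OF insert_promise_dnQ[OF below_subset[OF 2(2)]] 2(2)] .
  ultimately show ?thesis by blast
qed

text \<open>The core density argument. Since \<open>u\<close> is fixed before \<open>q'\<close>, the
  latter may first be chosen to put some \<open>v\<close> extending \<open>u\<close> into a dense
  set. The search in \<open>P\<close> then restarts from \<open>p\<close>, whose branch is the one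
  frozen.\<close>

lemma settled_dense:
  assumes "p \<in> P" "q \<in> Q"
  shows "\<exists>u. \<exists>q1\<in>dnQ q. \<forall>q'\<in>dnQ q1. \<forall>v. prefix u v \<longrightarrow>
    (\<exists>p2\<in>dn p. \<exists>q2\<in>dnQ q'. settled v p2 q2)"
proof -
  define q1 where "q1 = insert (Inr p) q"
  have q1: "q1 \<in> dnQ q" unfolding q1_def using insert_promise_dnQ[OF assms(2)] .
  have pq1: "p \<in> promise q1" by (simp add: promise_def q1_def)
  obtain L where L: "\<forall>v\<in>strs q1. length v < L" using length_bound[OF below_subset[OF q1]] by blast
  define s where "s = (\<lambda>n. map (branch p) [0..<n])"
  have ini: "initial (s n) (branch p)" and len: "length (s n) = n" for n
    by (simp_all add: s_def initial_def)
  have pre: "prefix (s n) (s m)" if "n \<le> m" for n m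
    using upt_add_eq_append[of 0 n "m - n"] that by (simp add: s_def prefix_def)
  \<comment> \<open>No string of \<open>q1\<close> has length \<open>L\<close> or more and
    \<open>p\<close> is promised, so below \<open>q1\<close> nothing beyond \<open>u\<close> is ever
    read along the branch.\<close>
  define u where "u = read (strs q1) (s L)"
  have "\<exists>p2\<in>dn p. \<exists>q2\<in>dnQ q'. settled v p2 q2" if q': "q' \<in> dnQ q1" and v: "prefix u v" for q' v
  proof -
    obtain w where w: "v = u @ w" using v by (auto simp: prefix_def)
    obtain L' where L': "\<forall>v\<in>strs q'. length v < L'" using length_bound[OF below_subset[OF q']] by blast
    \<comment> \<open>Past \<open>L\<close> the reading along the branch is \<open>u\<close>; past
      \<open>L'\<close> no string of \<open>q'\<close> interferes with the bits to be
      appended.\<close>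
    define M where "M = max L L'"
    obtain p1 where p1: "p1 \<in> dn p" "dec p1 (s M)" using branch[OF assms(1) ini] by blast
    have "read (strs q') (s M) = read (strs q1) (s M)" by (rule read_dnQ[OF q' pq1 ini])
    also have "\<dots> = u" unfolding u_def
      by (rule read_extend[OF pre]) (use L in \<open>auto simp: M_def len\<close>)
    finally have r: "read (strs q') (s M) = u" .
    have "length v < length (s M)" if "v \<in> strs q'" for v
      using L' that by (force simp: len M_def)
    then obtain p2 q2 t2 where 2: "p2 \<in> dn p1" "q2 \<in> dnQ q'" "dec p2 t2"
      "read (strs q2) t2 = v"
      using read_append[OF below_subset[OF p1(1)] below_subset[OF q'] p1(2), of w] r w by metis
    have "settled v p2 (insert (Inr p2) q2)"
      using settled_promiseI[OF below_subset[OF 2(1)] 2(3)] 2(4) by simp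
    moreover have "p2 \<in> dn p" using dn_trans[OF 2(1) p1(1)] .
    moreover have "insert (Inr p2) q2 \<in> dnQ q'"
      using dnQ_trans[OF insert_promise_dnQ[OF below_subset[OF 2(2)]] 2(2)] .
    ultimately show ?thesis by blast
  qed
  then show ?thesis using q1 by blast
qed

section \<open>The name for the Cohen real and its genericity\<close>

definition cohen_name :: "(nat \<times> bool) \<times> 'p \<Rightarrow> (nat + 'p) set \<Rightarrow> bool" where
  "cohen_name = member Not Q leQ (\<lambda>((x, p), q). cbit x p q)"

abbreviation ngQ :: "((nat + 'p) set \<Rightarrow> bool) \<Rightarrow> (nat + 'p) set \<Rightarrow> bool" where
  "ngQ \<equiv> fnot Not Q leQ"

lemma member_cohen_name:
  assumes "p \<in> P" "q \<in> Q"
  shows "member ngQ P leP cohen_name x p q \<longleftrightarrow>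
     (\<forall>p'\<in>dn p. \<forall>q'\<in>dnQ q. \<exists>p''\<in>dn p'. \<exists>q''\<in>dnQ q'. cbit x p'' q'')"
  unfolding cohen_name_def
  by (rule member_ext_name[OF po po_Q _ assms]) (rule cbit_mono)

lemma member_cohen_nameI:
  assumes "p \<in> P" "q \<in> Q" "cbit x p q"
  shows "member ngQ P leP cohen_name x p q"
  unfolding member_cohen_name[OF assms(1,2)]
  using cbit_mono[OF assms(3)] dn_refl dnQ_refl below_subset by metis

text \<open>\<open>settled_long\<close> fixes the bit at \<open>n\<close>, and comparability of
  settled strings excludes the other value further down.\<close>

lemma cohen_name_is_real:
  assumes "p \<in> P" "q \<in> Q"
  shows "is_real (fnot ngQ P leP) (member ngQ P leP cohen_name) p q"
proof -
  have "\<exists>p''\<in>dn p'. \<exists>q''\<in>dnQ q'. \<exists>b. member ngQ P leP cohen_name (n, b) p'' q'' \<and>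
      (\<forall>b'\<in>- {b}. \<forall>p3\<in>dn p''. \<forall>q3\<in>dnQ q''. \<not> member ngQ P leP cohen_name (n, b') p3 q3)"
    if p': "p' \<in> dn p" and q': "q' \<in> dnQ q" for n p' q'
  proof -
    obtain p'' q'' u where 1: "p'' \<in> dn p'" "q'' \<in> dnQ q'" "n < length u" "settled u p'' q''"
      using settled_long[OF below_subset[OF p'] below_subset[OF q']] by blast
    then have c: "cbit (n, u ! n) p'' q''" by (auto simp: cbit_def)
    have "\<not> member ngQ P leP cohen_name (n, b') p3 q3"
      if b': "b' \<noteq> u ! n" and p3: "p3 \<in> dn p''" and q3: "q3 \<in> dnQ q''" for b' p3 q3
    proof
      assume "member ngQ P leP cohen_name (n, b') p3 q3"
      then obtain p4 q4 where 4: "p4 \<in> dn p3" "q4 \<in> dnQ q3" "cbit (n, b') p4 q4"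
        unfolding member_cohen_name[OF below_subset[OF p3] below_subset[OF q3]]
        using dn_refl[OF below_subset[OF p3]] dnQ_refl[OF below_subset[OF q3]] by blast
      have "cbit (n, u ! n) p4 q4"
        using cbit_mono[OF c] dn_trans[OF 4(1) p3] dnQ_trans[OF 4(2) q3] by blast
      then show False using cbit_unique[OF below_subset[OF 4(1)]] 4(3) b' by blast
    qed
    then show ?thesis
      using 1(1,2) member_cohen_nameI[OF below_subset[OF 1(1)] below_subset[OF 1(2)] c] by blast
  qed
  then show ?thesis
    unfolding is_real_def by (simp add: ex_ext fnot_ext)
qed

lemma cohen_name_meets:
  assumes pq: "p \<in> P" "q \<in> Q"
    and dns: "dense (fnot ngQ P leP) (member ngQ P leP (check (member Not Q leQ \<delta>))) p q"
  shows "\<exists>p'\<in>dn p. \<exists>q'\<in>dnQ q. meets (fnot ngQ P leP) (member ngQ P leP cohen_name)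
           (member ngQ P leP (check (member Not Q leQ \<delta>))) p' q'"
proof -
  let ?D = "member Not Q leQ \<delta>"
  let ?D' = "member ngQ P leP (check ?D)"
  obtain u q1 where q1: "q1 \<in> dnQ q" and ext: "\<And>q' v. q' \<in> dnQ q1 \<Longrightarrow> prefix u v \<Longrightarrow>
      \<exists>p2\<in>dn p. \<exists>q2\<in>dnQ q'. settled v p2 q2"
    using settled_dense[OF pq] by blast
  have "\<forall>p'\<in>dn p. \<forall>q'\<in>dnQ q. \<exists>p''\<in>dn p'. \<exists>q''\<in>dnQ q'. \<exists>v\<in>{v. prefix u v}. ?D' v p'' q''"
    using dns unfolding dense_def by (simp add: ex_ext)
  then obtain p2 q2 v where 2: "p2 \<in> dn p" "q2 \<in> dnQ q1" "prefix u v" "?D' v p2 q2"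
    using dn_refl[OF pq(1)] q1 by blast
  obtain q3 where q3: "q3 \<in> dnQ q2" "?D v q3"
    using member_ext_checkD[OF po po_Q below_subset[OF 2(1)] below_subset[OF 2(2)] 2(4)] by blast
  \<comment> \<open>\<open>p2\<close> is abandoned: that \<open>v\<close> lies in the dense set
    rests on \<open>q3\<close> alone, which permits the return to a condition below \<open>p\<close>
    that settles \<open>v\<close>.\<close>
  obtain p4 q4 where 4: "p4 \<in> dn p" "q4 \<in> dnQ q3" "settled v p4 q4"
    using ext[OF dnQ_trans[OF q3(1) 2(2)] 2(3)] by blast
  \<comment> \<open>The existential in \<open>meets\<close> is a double negation, so the witness
    \<open>v\<close> has to survive arbitrary strengthening.\<close>
  have D4: "?D' v p' q'" and c4: "\<forall>i\<in>{..<length v}. member ngQ P leP cohen_name (i, v ! i) p' q'"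
    if p': "p' \<in> dn p4" and q': "q' \<in> dnQ q4" for p' q'
  proof -
    have PQ: "p' \<in> P" "q' \<in> Q" using below_subset p' q' by metis+
    have "?D v q'" using member_V_mono[OF po_Q q3(2) dnQ_trans[OF q' 4(2)]] .
    then show "?D' v p' q'" by (rule member_ext_checkI[OF po po_Q PQ])
    have "settled v p' q'" using settled_mono[OF 4(3) p' q'] .
    then show "\<forall>i\<in>{..<length v}. member ngQ P leP cohen_name (i, v ! i) p' q'"
      using member_cohen_nameI[OF PQ] by (auto simp: cbit_def)
  qed
  have "meets (fnot ngQ P leP) (member ngQ P leP cohen_name) ?D' p4 q4"
    unfolding meets_def ex_ext
  proof (intro ballI)
    fix p' q' assume p': "p' \<in> dn p4" and q': "q' \<in> dnQ q4"
    have "inf (?D' v) (INF i\<in>{..<length v}. member ngQ P leP cohen_name (i, v ! i)) p' q'"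
      using D4[OF p' q'] c4[OF p' q'] by simp
    then show "\<exists>p''\<in>dn p'. \<exists>q''\<in>dnQ q'. \<exists>s\<in>UNIV.
        inf (?D' s) (INF i\<in>{..<length s}. member ngQ P leP cohen_name (i, s ! i)) p'' q''"
      using dn_refl[OF below_subset[OF p']] dnQ_refl[OF below_subset[OF q']] by blast
  qed
  moreover have "q4 \<in> dnQ q" using 4(2) q3(1) 2(2) q1 dnQ_trans by blast
  ultimately show ?thesis using 4(1) by blast
qed

lemma cohen_name_cohen:
  assumes pq: "p \<in> P" "q \<in> Q"
  shows "cohen_over ngQ (ext_subsets Q leQ) P leP cohen_name p q"
proof -
  have "imp (fnot ngQ P leP) (dense (fnot ngQ P leP) (member ngQ P leP (check D)))
      (meets (fnot ngQ P leP) (member ngQ P leP cohen_name) (member ngQ P leP (check D))) p q"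
    if D: "D \<in> ext_subsets Q leQ" for D
  proof -
    obtain \<delta> where "D = member Not Q leQ \<delta>" using D by (auto simp: ext_subsets_def)
    then have "\<exists>p''\<in>dn p'. \<exists>q''\<in>dnQ q'. meets (fnot ngQ P leP) (member ngQ P leP cohen_name)
        (member ngQ P leP (check D)) p'' q''"
      if "p' \<in> dn p" "q' \<in> dnQ q" "dense (fnot ngQ P leP) (member ngQ P leP (check D)) p' q'" for p' q'
      using cohen_name_meets[OF below_subset[OF that(1)] below_subset[OF that(2)]] that(3) by simp
    then show ?thesis
      unfolding imp_def fnot_ext inf_apply inf_bool_def by blast
  qed
  then show ?thesis
    using cohen_name_is_real[OF pq] by (simp add: cohen_over_def Let_def)
qed

lemma forces_adds_cohen: "forces Q (adds_cohen_over_ext Q leQ P leP)"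
proof -
  have "cohen_name \<in> ext_subsets Q leQ" by (simp add: cohen_name_def ext_subsets_def)
  moreover have "forces P (cohen_over ngQ (ext_subsets Q leQ) P leP cohen_name) q" if "q \<in> Q" for q
    using cohen_name_cohen[OF _ that] by (simp add: forces_def)
  ultimately have "adds_cohen_over_ext Q leQ P leP q" if "q \<in> Q" for q
    unfolding adds_cohen_over_ext_def Let_def ex_V
    using dnQ_refl below_subset by metis
  then show ?thesis by (simp add: forces_def)
qed

end

theorem theoremC:
  fixes P :: "'p set" and leP :: "'p rel"
  assumes "partial_order_on P leP"
    and "adds_real P leP"
  shows "\<exists>(Q :: (nat + 'p) set set) leQ.
    Q \<noteq> {} \<and> partial_order_on Q leQ \<and> ccc Q leQ \<and>
    forces Q (adds_cohen_over_ext Q leQ P leP)"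
proof -
  obtain \<tau> where "forces P (new_real P leP \<tau>)"
    using assms(2) by (auto simp: adds_real_def)
  then interpret new_real_name P leP \<tau>
    using assms(1) by unfold_locales
  have "Q \<noteq> {}" by (auto simp: Q_def)
  then show ?thesis using po_Q ccc_Q forces_adds_cohen by blast
qed

end
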